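(* Let $n\in\mathbb{N}$, $n\geq 1$, let $\mu_1,\mu_2,\dots,\mu_n$ be (commuting) indeterminates, and let $M$ be the CI-matrix of size $n$ in these indeterminates, i.e. the $n\times n$ matrix, polynomial in $\mu_1,\dots,\mu_n$, whose entry in row $h$ and column $k$ ($1\leq h,k\leq n$) is $$M_{h,k}=\begin{cases}\displaystyle\sum_{\substack{i_1,i_2,\dots,i_{n-h}\in \mathscr{I}_k\\ i_1<i_2<\dots<i_{n-h}}}\mu_{i_1}\mu_{i_2}\cdots\mu_{i_{n-h}} & \text{if } h<n,\\[2mm] 1 & \text{if } h=n,\end{cases}$$ where $\mathscr{I}_k=\{1,2,\dots,n\}\setminus\{k\}$. Then, as polynomials in $\mu_1,\dots,\mu_n$, $$\det(M)=\prod_{1\leq i<j\leq n}(\mu_j-\mu_i).$$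
   Context: A controllability intermixing matrix (CI-matrix) of size $n$ in the indeterminates $\mu_1,\dots,\mu_n$ is the $n\times n$ matrix whose $(h,k)$ entry is the sum of the products of all unordered $(n-h)$-tuples of distinct indeterminates chosen from $\{\mu_i : i\neq k\}$ (that is, the elementary symmetric polynomial of degree $n-h$ in the $n-1$ indeterminates other than $\mu_k$), with the convention that the entry is $1$ when $h=n$. Thus the last row consists of ones, and the first row has entries $\prod_{i\neq k}\mu_i$, $k=1,\dots,n$. An empty product equals $1$. *)

theory Defs
  imports "HOL-Library.Poly_Mapping" "Jordan_Normal_Form.Determinant"
begin

(* Polynomials in commuting indeterminates indexed by nat, with coefficients in 'a:
   finitely supported maps from monomials (exponent functions nat \<Rightarrow>\<^sub>0 nat) to
   coefficients, multiplied by convolution. *)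
type_synonym 'a mpolynomial = "(nat \<Rightarrow>\<^sub>0 nat) \<Rightarrow>\<^sub>0 'a"

definition indet :: "nat \<Rightarrow> 'a::comm_ring_1 mpolynomial" where
  "indet i = Poly_Mapping.single (Poly_Mapping.single i 1) 1"

(* 1 \<le> h, k \<le> n. A product over increasing tuples i_1 < ... < i_(n-h) of elements of
   {1..n} - {k} is a product over a subset S with n - h elements. *)
definition CI_entry :: "nat \<Rightarrow> (nat \<Rightarrow> 'b::comm_ring_1) \<Rightarrow> nat \<Rightarrow> nat \<Rightarrow> 'b" where
  "CI_entry n \<mu> h k =
     (if h < n then \<Sum>S \<in> {S. S \<subseteq> {1..n} - {k} \<and> card S = n - h}. \<Prod>i\<in>S. \<mu> i
      else 1)"

(* Matrix indices start at 0, hence the shift. *)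
definition CI_matrix :: "nat \<Rightarrow> (nat \<Rightarrow> 'b::comm_ring_1) \<Rightarrow> 'b mat" where
  "CI_matrix n \<mu> = mat n n (\<lambda>(r, c). CI_entry n \<mu> (Suc r) (Suc c))"

end

theory Submission
  imports Defs
begin

text \<open>Subtracting the last column of the CI-matrix of size \<open>m + 1\<close> from column \<open>k \<le> m\<close> turns it into
  \<open>\<mu>\<^bsub>m+1\<^esub> - \<mu>\<^bsub>k\<^esub>\<close> times column \<open>k\<close> of the CI-matrix of size \<open>m\<close>, above a zero: by
  \<open>e\<^bsub>d+1\<^esub>(R \<union> {x}) = e\<^bsub>d+1\<^esub>(R) + x e\<^bsub>d\<^esub>(R)\<close>, the difference \<open>e\<^bsub>d+1\<^esub>(R \<union> {x}) - e\<^bsub>d+1\<^esub>(R \<union> {y})\<close>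
  equals \<open>(x - y) e\<^bsub>d\<^esub>(R)\<close>. Hence the determinants satisfy the Vandermonde recursion, over any
  commutative ring.\<close>

text \<open>The elementary symmetric polynomial of degree \<open>d\<close> in the values
  \<open>\<mu> i\<close> with \<open>i \<in> R\<close>. The index set is a parameter so that single
  indices can be added or left out.\<close>

definition esym :: "('i \<Rightarrow> 'b::comm_ring_1) \<Rightarrow> nat \<Rightarrow> 'i set \<Rightarrow> 'b" where
  "esym \<mu> d R = (\<Sum>S \<in> {S. S \<subseteq> R \<and> card S = d}. \<Prod>i\<in>S. \<mu> i)"

lemma esym_0:
  assumes "finite R"
  shows "esym \<mu> 0 R = 1"
proof -
  \<comment> \<open>Finiteness of \<open>R\<close> matters here: an infinite subset would also have
    \<open>card\<close> 0.\<close>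
  have "{S. S \<subseteq> R \<and> card S = 0} = {{}}"
    using assms by (auto dest: finite_subset)
  then show ?thesis by (simp add: esym_def)
qed

text \<open>Sort the subsets of \<open>insert x R\<close> by whether they contain \<open>x\<close>;
  those that do arise from a \<open>d\<close>-subset of \<open>R\<close> by adding
  \<open>x\<close>.\<close>

lemma esym_insert:
  assumes "finite R" "x \<notin> R"
  shows "esym \<mu> (Suc d) (insert x R) = esym \<mu> (Suc d) R + \<mu> x * esym \<mu> d R"
proof -
  let ?A = "{S. S \<subseteq> R \<and> card S = Suc d}" and ?B = "{S. S \<subseteq> R \<and> card S = d}"
  have fin: "finite S" and notin: "x \<notin> S" if "S \<subseteq> R" for S
    using that assms finite_subset by auto
  have split: "{S. S \<subseteq> insert x R \<and> card S = Suc d} = ?A \<union> insert x ` ?B"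
  proof (intro subset_antisym subsetI)
    fix S assume S: "S \<in> {S. S \<subseteq> insert x R \<and> card S = Suc d}"
    show "S \<in> ?A \<union> insert x ` ?B"
    proof (cases "x \<in> S")
      case True
      then have "S = insert x (S - {x})" "S - {x} \<in> ?B"
        using S by (auto simp: card_Diff_singleton)
      then show ?thesis by blast
    qed (use S in auto)
  qed (use fin notin in auto)
  have inj: "inj_on (insert x) ?B"
    by (rule inj_onI) (metis (mono_tags, lifting) insert_ident mem_Collect_eq notin)
  have "esym \<mu> (Suc d) (insert x R) = (\<Sum>S\<in>?A. prod \<mu> S) + (\<Sum>S\<in>insert x ` ?B. prod \<mu> S)"
    unfolding esym_def split using assms by (intro sum.union_disjoint) auto
  also have "(\<Sum>S\<in>insert x ` ?B. prod \<mu> S) = (\<Sum>S\<in>?B. \<mu> x * prod \<mu> S)"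
    by (simp add: sum.reindex[OF inj] fin notin)
  finally show ?thesis by (simp add: esym_def sum_distrib_left)
qed

lemma CI_entry_esym:
  assumes "h \<le> n"
  shows "CI_entry n \<mu> h k = esym \<mu> (n - h) ({1..n} - {k})"
  using assms esym_0[of "{1..n} - {k}" \<mu>] by (auto simp: CI_entry_def esym_def)

lemma CI_entry_diff_last:
  assumes "1 \<le> k" "k \<le> m" "h \<le> m"
  shows "CI_entry (Suc m) \<mu> h k =
    CI_entry m \<mu> h k * (\<mu> (Suc m) - \<mu> k) + CI_entry (Suc m) \<mu> h (Suc m)"
proof -
  define R where "R = {1..m} - {k}"
  \<comment> \<open>The two index sets extend the same \<open>R\<close> by one element each, so the
    terms of \<open>esym_insert\<close> free of that element cancel in the difference.\<close>
  have ins: "{1..Suc m} - {k} = insert (Suc m) R" "{1..Suc m} - {Suc m} = insert k R"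
    using assms by (auto simp: R_def)
  have R: "finite R" "Suc m \<notin> R" "k \<notin> R" by (auto simp: R_def)
  have "CI_entry (Suc m) \<mu> h j = esym \<mu> (Suc (m - h)) ({1..Suc m} - {j})" for j
    using assms CI_entry_esym[of h "Suc m" \<mu> j] by (simp add: Suc_diff_le)
  moreover have "CI_entry m \<mu> h k = esym \<mu> (m - h) R"
    using assms CI_entry_esym[of h m \<mu> k] by (simp add: R_def)
  ultimately show ?thesis
    unfolding ins esym_insert[OF R(1,2)] esym_insert[OF R(1,3)]
    by (simp add: ins esym_insert R algebra_simps del: One_nat_def)
qed

text \<open>The column operations as a factorization: the right factor adds the last column to every
  other one, undoing the subtraction whose result is the left factor.\<close>

lemma CI_matrix_Suc:
  fixes \<mu> :: "nat \<Rightarrow> 'b::comm_ring_1"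
  shows "CI_matrix (Suc m) \<mu> =
    four_block_mat (CI_matrix m \<mu> * mat_diag m (\<lambda>c. \<mu> (Suc m) - \<mu> (Suc c)))
      (mat m 1 (\<lambda>(r, c). CI_entry (Suc m) \<mu> (Suc r) (Suc m))) (0\<^sub>m 1 m) (1\<^sub>m 1) *
    four_block_mat (1\<^sub>m m) (0\<^sub>m m 1) (mat 1 m (\<lambda>_. 1)) (1\<^sub>m 1)"
    (is "_ = four_block_mat ?A ?b _ _ * four_block_mat _ _ ?r _")
proof -
  have M: "CI_matrix m \<mu> \<in> carrier_mat m m" by (simp add: CI_matrix_def)
  then have A: "?A \<in> carrier_mat m m" by simp
  have "four_block_mat ?A ?b (0\<^sub>m 1 m) (1\<^sub>m 1) * four_block_mat (1\<^sub>m m) (0\<^sub>m m 1) ?r (1\<^sub>m 1) =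
    four_block_mat (?A + ?b * ?r) ?b ?r (1\<^sub>m 1)"
    using mult_four_block_mat[OF A, of ?b 1 "0\<^sub>m 1 m" 1 "1\<^sub>m 1" "1\<^sub>m m" m "0\<^sub>m m 1" 1 ?r]
      right_mult_one_mat[OF A] right_mult_zero_mat[OF A, of 1]
    by (simp del: One_nat_def)
  also have "\<dots> = CI_matrix (Suc m) \<mu>"
  proof (rule eq_matI)
    fix i j assume "i < dim_row (CI_matrix (Suc m) \<mu>)" "j < dim_col (CI_matrix (Suc m) \<mu>)"
    then have "i < Suc m" "j < Suc m" by (auto simp: CI_matrix_def)
    \<comment> \<open>Upper left block, last column above the corner, and bottom row of
      ones.\<close>
    then consider "i < m" "j < m" | "i < m" "j = m" | "i = m" "j \<le> m" by linarith
    then show "four_block_mat (?A + ?b * ?r) ?b ?r (1\<^sub>m 1) $$ (i, j) = CI_matrix (Suc m) \<mu> $$ (i, j)"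
    proof cases
      case 1
      then have "?A $$ (i, j) = CI_entry m \<mu> (Suc i) (Suc j) * (\<mu> (Suc m) - \<mu> (Suc j))"
        unfolding mat_diag_mult_right[OF M] by (simp add: CI_matrix_def)
      moreover have "(?b * ?r) $$ (i, j) = CI_entry (Suc m) \<mu> (Suc i) (Suc m)"
        using 1 by (simp add: scalar_prod_def)
      ultimately show ?thesis
        using 1 A CI_entry_diff_last[of "Suc j" m "Suc i" \<mu>] by (simp add: CI_matrix_def)
    next
      case 2
      then show ?thesis by (simp add: CI_matrix_def)
    next
      case 3
      then show ?thesis by (auto simp: CI_matrix_def CI_entry_def)
    qed
  qed (use A in \<open>auto simp: CI_matrix_def\<close>)
  finally show ?thesis ..
qed

text \<open>Transposition moves the zero block to the upper right, where the library formula for a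
  zero column applies.\<close>

lemma det_four_block_mat_border_lower_zero:
  fixes A :: "'b::comm_ring_1 mat"
  assumes "A \<in> carrier_mat m m" "b \<in> carrier_mat m 1" "d \<in> carrier_mat 1 1"
  shows "det (four_block_mat A b (0\<^sub>m 1 m) d) = det A * det d"
proof -
  have "det (four_block_mat A b (0\<^sub>m 1 m) d) =
      det (four_block_mat (transpose_mat A) (0\<^sub>m m 1) (transpose_mat b) (transpose_mat d))"
    using assms det_transpose[OF four_block_carrier_mat[OF assms(1,3)], of b "0\<^sub>m 1 m"]
    by (simp add: transpose_four_block_mat[of _ m m _ 1 _ 1])
  also have "\<dots> = det A * det d"
    using assms by (subst det_four_block_mat_upper_right_zero_col[of _ m]) (auto simp: det_transpose)
  finally show ?thesis .
qed

lemma det_mat_diag: "det (mat_diag m f) = (\<Prod>i<m. f i)"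
proof -
  have "det (mat_diag m f) = prod_list (diag_mat (mat_diag m f))"
    by (rule det_upper_triangular[of _ m]) (auto simp: mat_diag_def)
  then show ?thesis
    by (simp add: prod_list_diag_prod mat_diag_def atLeast0LessThan)
qed

lemma det_CI_matrix_Suc:
  "det (CI_matrix (Suc m) \<mu>) = det (CI_matrix m \<mu>) * (\<Prod>i\<in>{1..m}. \<mu> (Suc m) - \<mu> i)"
proof -
  define D where "D = mat_diag m (\<lambda>c. \<mu> (Suc m) - \<mu> (Suc c))"
  define b where "b = mat m 1 (\<lambda>(r, c). CI_entry (Suc m) \<mu> (Suc r) (Suc m))"
  define N where "N = four_block_mat (CI_matrix m \<mu> * D) b (0\<^sub>m 1 m) (1\<^sub>m 1)"
  define L :: "'a mat"
    where "L = four_block_mat (1\<^sub>m m) (0\<^sub>m m 1) (mat 1 m (\<lambda>_. 1)) (1\<^sub>m 1)"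
  have M: "CI_matrix m \<mu> \<in> carrier_mat m m" by (simp add: CI_matrix_def)
  have D: "D \<in> carrier_mat m m" and b: "b \<in> carrier_mat m 1" by (simp_all add: D_def b_def)
  have "N \<in> carrier_mat (m + 1) (m + 1)" "L \<in> carrier_mat (m + 1) (m + 1)"
    unfolding N_def L_def using M D by (intro four_block_carrier_mat; simp)+
  then have "det (CI_matrix (Suc m) \<mu>) = det N * det L"
    unfolding CI_matrix_Suc D_def[symmetric] b_def[symmetric] N_def[symmetric] L_def[symmetric]
    by (rule det_mult)
  also have "det L = 1"
    unfolding L_def by (subst det_four_block_mat_upper_right_zero_col[of _ m]) auto
  also have "det N = det (CI_matrix m \<mu>) * det D"
    using det_four_block_mat_border_lower_zero[OF mult_carrier_mat[OF M D] b one_carrier_mat]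
    by (simp add: N_def det_mult[OF M D])
  also have "det D = (\<Prod>i\<in>{1..m}. \<mu> (Suc m) - \<mu> i)"
    \<comment> \<open>The diagonal is indexed from 0, hence the shift to
      \<open>{1..m}\<close>.\<close>
    by (simp add: D_def det_mat_diag prod.atLeast1_atMost_eq)
  finally show ?thesis by simp
qed

text \<open>Induction on the size from the empty matrix, with determinant 1; the new factors come
  from the pairs \<open>(i, Suc m)\<close>.\<close>

theorem det_CI_matrix:
  "det (CI_matrix n \<mu>) = (\<Prod>(i, j) \<in> {(i, j). 1 \<le> i \<and> i < j \<and> j \<le> n}. \<mu> j - \<mu> i)"
proof (induction n)
  case 0
  have "{(i, j). 1 \<le> i \<and> i < j \<and> j \<le> (0::nat)} = {}" by auto
  then show ?case by (simp only: prod.empty) (simp add: CI_matrix_def)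
next
  case (Suc m)
  let ?P = "\<lambda>n. {(i, j). 1 \<le> i \<and> i < j \<and> j \<le> n}"
  have "?P (Suc m) = ?P m \<union> (\<lambda>i. (i, Suc m)) ` {1..m}" by auto
  moreover have "finite (?P m)"
    by (rule finite_subset[of _ "{1..m} \<times> {1..m}"]) auto
  moreover have "?P m \<inter> (\<lambda>i. (i, Suc m)) ` {1..m} = {}" by auto
  ultimately have "(\<Prod>(i, j)\<in>?P (Suc m). \<mu> j - \<mu> i) =
    (\<Prod>(i, j)\<in>?P m. \<mu> j - \<mu> i) * (\<Prod>i\<in>{1..m}. \<mu> (Suc m) - \<mu> i)"
    by (simp add: prod.union_disjoint prod.reindex inj_on_def)
  then show ?case by (simp add: det_CI_matrix_Suc Suc.IH)
qed

theorem theorem1: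
  fixes n :: nat
  assumes "n \<ge> 1"
  shows "det (CI_matrix n (indet :: nat \<Rightarrow> 'a::comm_ring_1 mpolynomial)) =
    (\<Prod>(i, j) \<in> {(i, j). 1 \<le> i \<and> i < j \<and> j \<le> n}. indet j - indet i)"
  \<comment> \<open>The identity over any commutative ring is specialized to the polynomial
    ring.\<close>
  by (rule det_CI_matrix)

end
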